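(* Let $\mathcal C_1,\dots,\mathcal C_T\subseteq\mathbb R^d$ be closed convex sets with nonempty intersection $\mathcal C_\star=\bigcap_{m=1}^T\mathcal C_m\ne\varnothing$, with Euclidean projections $\Pi_m$. Let $\mathbf w_0\in\mathbb R^d$, let $\tau$ be a random ordering with or without replacement, and let $\mathbf w_t=\Pi_{\tau(t)}(\mathbf w_{t-1})$ for $t=1,\dots,k$. Then for every $k\ge1$ (respectively every $k\in\{1,\dots,T\}$ when $\tau$ is without replacement), $$\mathbb E_\tau\Big[\frac1{2T}\sum_{m=1}^T\|\mathbf w_k-\Pi_m(\mathbf w_k)\|^2\Big]=\mathbb E_\tau\Big[\frac1{2T}\sum_{m=1}^T\operatorname{dist}^2(\mathbf w_k,\mathcal C_m)\Big]\le\frac{7}{\sqrt[4]{k}}\min_{\mathbf w\in\mathcal C_\star}\|\mathbf w_0-\mathbf w\|^2 .$$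
   Context: $\|\cdot\|$ is the Euclidean norm, $\Pi_m(\mathbf w)=\operatorname{argmin}_{\mathbf v\in\mathcal C_m}\|\mathbf v-\mathbf w\|$, $\operatorname{dist}(\mathbf w,\mathcal C)=\min_{\mathbf v\in\mathcal C}\|\mathbf w-\mathbf v\|$. Random ordering: $\tau(1),\dots,\tau(k)$ are drawn uniformly from $\{1,\dots,T\}$, either i.i.d. (with replacement) or as the first $k$ entries of a uniformly random permutation (without replacement). *)

theory Defs
  imports "HOL-Probability.Probability" "HOL-Combinatorics.Permutations"
begin

primrec projection_iterates ::
    "(nat \<Rightarrow> 'a::euclidean_space set) \<Rightarrow> (nat \<Rightarrow> nat) \<Rightarrow> 'a \<Rightarrow> nat \<Rightarrow> 'a" where
  "projection_iterates C \<tau> w0 0 = w0"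
| "projection_iterates C \<tau> w0 (Suc t) =
     closest_point (C (\<tau> (Suc t))) (projection_iterates C \<tau> w0 t)"

text \<open>
  An ordering is a function \<open>\<tau>\<close> whose values \<open>\<tau> 1, \<dots>, \<tau> k\<close> are the drawn indices; its values
  outside \<open>{1..k}\<close> never enter the first \<open>k\<close> iterates. In the i.i.d. case these other values
  are set to the dummy \<open>0\<close>.
\<close>

definition ordering_with_replacement :: "nat \<Rightarrow> nat \<Rightarrow> (nat \<Rightarrow> nat) pmf" where
  "ordering_with_replacement T k = Pi_pmf {1..k} 0 (\<lambda>_. pmf_of_set {1..T})"

definition ordering_without_replacement :: "nat \<Rightarrow> (nat \<Rightarrow> nat) pmf" where
  "ordering_without_replacement T = pmf_of_set {\<pi>. \<pi> permutes {1..T}}"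

text \<open>
  The following two facts show that, for closed nonempty sets, \<open>infdist\<close> and the
  infimum of squared distances are attained, i.e.\ are genuine minima.
\<close>

lemma infdist_is_min:
  fixes S :: "'a::euclidean_space set"
  assumes "closed S" "S \<noteq> {}"
  shows "\<exists>v\<in>S. infdist w S = norm (w - v) \<and> (\<forall>u\<in>S. norm (w - v) \<le> norm (w - u))"
proof -
  obtain v where "v \<in> S" "infdist w S = dist w v"
    using infdist_attains_inf[OF assms] by metis
  then show ?thesis
    by (metis dist_norm infdist_le)
qed

lemma INF_norm_sq_is_min:
  fixes S :: "'a::euclidean_space set"
  assumes "closed S" "S \<noteq> {}"
  shows "\<exists>v\<in>S. (INF u\<in>S. (norm (w - u))\<^sup>2) = (norm (w - v))\<^sup>2 \<and>
           (\<forall>u\<in>S. (norm (w - v))\<^sup>2 \<le> (norm (w - u))\<^sup>2)"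
proof -
  obtain v where v: "v \<in> S" "\<forall>u\<in>S. norm (w - v) \<le> norm (w - u)"
    using infdist_is_min[OF assms] by metis
  have le: "\<forall>u\<in>S. (norm (w - v))\<^sup>2 \<le> (norm (w - u))\<^sup>2"
    using v(2) by (simp add: power_mono)
  have "(INF u\<in>S. (norm (w - u))\<^sup>2) = (norm (w - v))\<^sup>2"
    by (rule cInf_eq_minimum) (use v(1) le in auto)
  then show ?thesis
    using v(1) le by blast
qed

end

theory Submission
  imports Defs
begin

text \<open>
  Let \<open>d\<^sub>m\<close> be the distance to \<open>C m\<close> and \<open>b\<^sub>t\<close> the expectation of \<open>d\<^sub>m(w\<^sub>t)\<^sup>2\<close> for the next drawn
  index \<open>m = \<tau>(t + 1)\<close>. Projecting onto \<open>C m\<close> satisfies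
  \<open>\<parallel>\<Pi>\<^sub>m w - z\<parallel>\<^sup>2 \<le> \<parallel>w - z\<parallel>\<^sup>2 - d\<^sub>m(w)\<^sup>2 / 2 + 2 d\<^sub>m(z)\<^sup>2\<close> for every \<open>z\<close>. Taking for \<open>z\<close> an earlier iterate
  \<open>w\<^sub>s\<close>, exchangeability of the order (valid with and without replacement) gives every later
  \<open>d\<^sub>m(w\<^sub>s)\<^sup>2\<close> the expectation \<open>b\<^sub>s\<close>, so \<open>b\<^sub>s + \<dots> + b\<^bsub>k-1\<^esub> \<le> 4 (k - s) b\<^sub>s\<close>. Together with
  \<open>b\<^sub>0 + \<dots> + b\<^bsub>k-1\<^esub> \<le> \<parallel>w\<^sub>0 - z\<parallel>\<^sup>2\<close> for \<open>z\<close> in the intersection, this forces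
  \<open>b\<^bsub>k-1\<^esub> = O(k\<^bsup>-1/4\<^esup>)\<close>. Without replacement, sets that were already visited are compared with
  fresh ones by exchanging two positions of the order; the cost is a sum of \<open>b\<^sub>t\<close> divided by \<open>T\<close>.
\<close>

section \<open>Euclidean projections\<close>

lemma norm_diff_sq_le_double:
  fixes x y z :: "'a::real_inner"
  shows "(norm (x - z))\<^sup>2 \<le> 2 * (norm (x - y))\<^sup>2 + 2 * (norm (y - z))\<^sup>2"
proof -
  have "(norm ((x - y) - (y - z)))\<^sup>2 \<ge> 0"
    by simp
  moreover have "(norm ((x - y) - (y - z)))\<^sup>2 + (norm (x - z))\<^sup>2
      = 2 * (norm (x - y))\<^sup>2 + 2 * (norm (y - z))\<^sup>2"
    by (simp add: power2_norm_eq_inner inner_commute algebra_simps)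
  ultimately show ?thesis
    by linarith
qed

lemma infdist_eq_norm_closest_point:
  fixes S :: "'a::euclidean_space set"
  assumes "closed S" "S \<noteq> {}"
  shows "infdist w S = norm (w - closest_point S w)"
proof (rule antisym)
  show "infdist w S \<le> norm (w - closest_point S w)"
    using infdist_le[OF closest_point_in_set[OF assms]] by (simp add: dist_norm)
  show "norm (w - closest_point S w) \<le> infdist w S"
    using infdist_is_min[OF assms] closest_point_le[OF assms(1)]
    by (metis dist_norm)
qed

text \<open>
  With \<open>a = w - \<Pi> w\<close>, \<open>c = z - \<Pi> z\<close> the obtuse-angle property bounds the left side by
  \<open>\<parallel>w - z\<parallel>\<^sup>2 - \<parallel>a\<parallel>\<^sup>2 + 2 (a \<bullet> c)\<close>, and \<open>2 (a \<bullet> c) \<le> \<parallel>a\<parallel>\<^sup>2 / 2 + 2 \<parallel>c\<parallel>\<^sup>2\<close>.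
\<close>
lemma closest_point_step:
  fixes S :: "'a::euclidean_space set"
  assumes "convex S" "closed S" "S \<noteq> {}"
  shows "(norm (closest_point S w - z))\<^sup>2
      \<le> (norm (w - z))\<^sup>2 - (norm (w - closest_point S w))\<^sup>2 / 2
          + 2 * (norm (z - closest_point S z))\<^sup>2"
proof -
  define p q where "p = closest_point S w" and "q = closest_point S z"
  have obtuse: "(w - p) \<bullet> (q - p) \<le> 0"
    unfolding p_def q_def by (intro closest_point_dot assms closest_point_in_set)
  have sq: "0 \<le> (norm ((w - p) - 2 *\<^sub>R (z - q)))\<^sup>2"
    by simp
  have "(norm (w - z))\<^sup>2 - (norm (w - p))\<^sup>2 / 2 + 2 * (norm (z - q))\<^sup>2 - (norm (p - z))\<^sup>2
      = (norm ((w - p) - 2 *\<^sub>R (z - q)))\<^sup>2 / 2 - 2 * ((w - p) \<bullet> (q - p))"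
    unfolding power2_norm_eq_inner inner_diff_left inner_diff_right inner_scaleR_left inner_scaleR_right
    by (simp add: inner_commute field_simps)
  with obtuse sq show ?thesis
    unfolding p_def q_def by linarith
qed

text \<open>For \<open>z\<close> in \<open>S\<close> the obtuse-angle property applies to
  \<open>z\<close> itself, so the whole squared residual is gained instead of half. This keeps the
  constant 1 in the sum of all residuals.\<close>

lemma closest_point_step_in:
  fixes S :: "'a::euclidean_space set"
  assumes "convex S" "closed S" "z \<in> S"
  shows "(norm (closest_point S w - z))\<^sup>2 \<le> (norm (w - z))\<^sup>2 - (norm (w - closest_point S w))\<^sup>2"
proof -
  define p where "p = closest_point S w"
  have obtuse: "(w - p) \<bullet> (z - p) \<le> 0"
    unfolding p_def by (rule closest_point_dot[OF assms])
  have "(norm (w - z))\<^sup>2 - (norm (w - p))\<^sup>2 - (norm (p - z))\<^sup>2 = - 2 * ((w - p) \<bullet> (z - p))"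
    by (simp add: power2_norm_eq_inner inner_commute algebra_simps)
  with obtuse show ?thesis
    unfolding p_def by linarith
qed

text \<open>\<open>closest_point S w\<close> is a competitor for the point of \<open>S\<close>
  nearest to \<open>v\<close>. This moves a residual from one iterate to another at the price of
  their distance.\<close>

lemma closest_point_residual_le:
  fixes S :: "'a::euclidean_space set"
  assumes "closed S" "S \<noteq> {}"
  shows "(norm (v - closest_point S v))\<^sup>2
      \<le> 2 * (norm (v - w))\<^sup>2 + 2 * (norm (w - closest_point S w))\<^sup>2"
proof -
  have "norm (v - closest_point S v) \<le> norm (v - closest_point S w)"
    using closest_point_le[OF assms(1) closest_point_in_set[OF assms]] by (simp add: dist_norm)
  then have "(norm (v - closest_point S v))\<^sup>2 \<le> (norm (v - closest_point S w))\<^sup>2"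
    by (simp add: power_mono)
  also have "\<dots> \<le> 2 * (norm (v - w))\<^sup>2 + 2 * (norm (w - closest_point S w))\<^sup>2"
    by (rule norm_diff_sq_le_double)
  finally show ?thesis .
qed

section \<open>Trajectories of two orders that share some of their draws\<close>

lemma projection_iterates_cong:
  assumes "\<And>i. i \<in> {1..n} \<Longrightarrow> \<sigma> i = \<tau> i"
  shows "projection_iterates C \<sigma> w0 n = projection_iterates C \<tau> w0 n"
  using assms
proof (induction n)
  case (Suc n)
  then have "projection_iterates C \<sigma> w0 n = projection_iterates C \<tau> w0 n"
    by simp
  with Suc.prems[of "Suc n"] show ?case
    by simp
qed simp

text \<open>From time \<open>m\<close> on both trajectories undergo the same projections, and each
  of these is 1-Lipschitz.\<close>

lemma projection_iterates_nonexpansive: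
  assumes "m \<le> n"
    and "\<And>i. i \<in> {Suc m..n} \<Longrightarrow> \<sigma> i = \<tau> i"
    and "\<And>i. i \<in> {Suc m..n} \<Longrightarrow> convex (C (\<tau> i)) \<and> closed (C (\<tau> i)) \<and> C (\<tau> i) \<noteq> {}"
  shows "norm (projection_iterates C \<sigma> w0 n - projection_iterates C \<tau> w0 n)
    \<le> norm (projection_iterates C \<sigma> w0 m - projection_iterates C \<tau> w0 m)"
  using assms
proof (induction n rule: dec_induct)
  case base
  show ?case by simp
next
  case (step n)
  have "norm (projection_iterates C \<sigma> w0 (Suc n) - projection_iterates C \<tau> w0 (Suc n))
      \<le> norm (projection_iterates C \<sigma> w0 n - projection_iterates C \<tau> w0 n)"
    using closest_point_lipschitz[of "C (\<tau> (Suc n))"] step.prems step.hyps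
    by (auto simp: dist_norm)
  also have "\<dots> \<le> norm (projection_iterates C \<sigma> w0 m - projection_iterates C \<tau> w0 m)"
    using step by auto
  finally show ?case .
qed


section \<open>Sequences dominated by their last terms\<close>

text \<open>
  With \<open>A m\<close> the sum of the last \<open>m\<close> terms, the hypothesis reads
  \<open>A (m - 1) \<le> (1 - 1 / (4 m)) A m\<close>, and \<open>(1 - 1 / (4 m)) ^ 4 \<le> m / (m + 1)\<close> makes the
  product of these factors telescope.
\<close>
lemma last_term_bound:
  fixes b :: "nat \<Rightarrow> real"
  assumes nonneg: "\<And>t. t < k \<Longrightarrow> 0 \<le> b t"
    and tail: "\<And>s. s < k \<Longrightarrow> (\<Sum>t=s..<k. b t) \<le> 4 * real (k - s) * b s"
    and "k \<ge> 1"
  shows "(b (k - 1)) ^ 4 * (real k + 1) \<le> 2 * (\<Sum>t<k. b t) ^ 4"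
proof -
  define A where "A m = (\<Sum>t=k-m..<k. b t)" for m
  have A_nonneg: "0 \<le> A m" for m
    unfolding A_def by (intro sum_nonneg nonneg) auto
  have factor: "(A m) ^ 4 * (real m + 2) \<le> (A (Suc m)) ^ 4 * (real m + 1)" if "m < k" for m
  proof -
    define x where "x = 1 / (4 * (real m + 1))"
    have x: "0 \<le> x" "x \<le> 1" "4 * x * (real m + 1) = 1"
      by (auto simp: x_def field_simps)
    have "k - Suc m < k" "Suc (k - Suc m) = k - m"
      using that by auto
    then have "A (Suc m) = b (k - Suc m) + A m"
      unfolding A_def by (simp add: sum.atLeast_Suc_lessThan)
    moreover have "A (Suc m) \<le> 4 * (real m + 1) * b (k - Suc m)"
      using tail[of "k - Suc m"] that by (simp add: A_def add.commute)
    ultimately have "A (Suc m) \<le> 4 * (real m + 1) * (A (Suc m) - A m)"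
      by simp
    then have "x * A (Suc m) \<le> x * (4 * (real m + 1) * (A (Suc m) - A m))"
      by (rule mult_left_mono[OF _ x(1)])
    also have "\<dots> = A (Suc m) - A m"
      using x(3) by (simp add: x_def)
    finally have "A m \<le> (1 - x) * A (Suc m)"
      by (simp add: algebra_simps)
    then have "(A m) ^ 4 \<le> ((1 - x) * A (Suc m)) ^ 4"
      by (intro power_mono A_nonneg)
    then have "(A m) ^ 4 * (real m + 2) \<le> ((1 - x) * A (Suc m)) ^ 4 * (real m + 2)"
      by (rule mult_right_mono) simp
    then have 1: "(A m) ^ 4 * (real m + 2) \<le> ((1 - x) ^ 4 * (real m + 2)) * (A (Suc m)) ^ 4"
      by (simp only: power_mult_distrib mult_ac)
    \<comment> \<open>Bernoulli's inequality replaces \<open>1 + 4 * x\<close> by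
      \<open>(1 + x) ^ 4\<close>, and the product collapses to a power of
      \<open>1 - x\<^sup>2\<close>. The choice of \<open>x\<close> makes \<open>1 + 4 * x\<close>
      equal to \<open>(m + 2) / (m + 1)\<close>.\<close>
    have "(1 - x) ^ 4 * (1 + 4 * x) \<le> (1 - x) ^ 4 * (1 + x) ^ 4"
      using Bernoulli_inequality[of x 4] x by (intro mult_left_mono) (auto simp: mult.commute)
    also have "\<dots> = (1 - x\<^sup>2) ^ 4"
      by (simp add: power_mult_distrib[symmetric] power2_eq_square algebra_simps)
    also have "\<dots> \<le> 1"
      using x by (intro power_le_one) (auto simp: power_le_one)
    finally have "(1 - x) ^ 4 * (1 + 4 * x) * (real m + 1) \<le> 1 * (real m + 1)"
      by (intro mult_right_mono) auto
    moreover have "(1 + 4 * x) * (real m + 1) = real m + 2"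
      using x(3) by (simp add: algebra_simps)
    ultimately have "(1 - x) ^ 4 * (real m + 2) \<le> real m + 1"
      by (metis mult.assoc mult_1)
    then have "((1 - x) ^ 4 * (real m + 2)) * (A (Suc m)) ^ 4 \<le> (real m + 1) * (A (Suc m)) ^ 4"
      by (rule mult_right_mono) auto
    with 1 show ?thesis
      by (simp only: mult.commute[of _ "A (Suc m) ^ 4"])
  qed
  \<comment> \<open>The factors telescope from \<open>A 1\<close>, which is the last term
    \<open>b (k - 1)\<close>, up to \<open>A k\<close>, the full sum. The constant 2 is
    \<open>m + 1\<close> at the start \<open>m = 1\<close>.\<close>
  have "(A 1) ^ 4 * (real m + 1) \<le> 2 * (A m) ^ 4" if "1 \<le> m" "m \<le> k" for m
    using that
  proof (induction m rule: dec_induct)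
    case base
    show ?case by simp
  next
    case (step m)
    have "((A 1) ^ 4 * (real m + 2)) * (real m + 1) \<le> 2 * ((A m) ^ 4 * (real m + 2))"
      using step mult_right_mono[of "(A 1) ^ 4 * (real m + 1)" "2 * (A m) ^ 4" "real m + 2"]
      by (simp add: mult_ac)
    also have "\<dots> \<le> (2 * (A (Suc m)) ^ 4) * (real m + 1)"
      using factor[of m] step.prems
      by simp
    finally have "(A 1) ^ 4 * (real m + 2) \<le> 2 * (A (Suc m)) ^ 4"
      by (rule mult_right_le_imp_le) simp
    then show ?case
      by (simp add: add.commute add.left_commute)
  qed
  from this[of k] \<open>k \<ge> 1\<close> show ?thesis
    by (cases k) (auto simp: A_def atLeast0LessThan)
qed


section \<open>Projections in an exchangeable order\<close>

text \<open>Common setting for both kinds of order: \<open>N\<close> counts the exchangeable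
  positions, which is \<open>k\<close> with replacement and \<open>T\<close> without. Invariance is
  stated for transpositions because each use swaps just two positions.\<close>

locale exchangeable_projections =
  fixes C :: "nat \<Rightarrow> 'a::euclidean_space set" and w0 z :: 'a and I :: "nat set"
    and P :: "(nat \<Rightarrow> nat) pmf" and N :: nat
  assumes closed: "m \<in> I \<Longrightarrow> closed (C m)"
    and convex: "m \<in> I \<Longrightarrow> convex (C m)"
    and z_in: "m \<in> I \<Longrightarrow> z \<in> C m"
    and finite_support: "finite (set_pmf P)"
    and index: "\<tau> \<in> set_pmf P \<Longrightarrow> i \<in> {1..N} \<Longrightarrow> \<tau> i \<in> I"
    and exchangeable: "i \<in> {1..N} \<Longrightarrow> j \<in> {1..N} \<Longrightarrow> map_pmf (\<lambda>\<tau>. \<tau> \<circ> Transposition.transpose i j) P = P"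
begin

abbreviation w :: "(nat \<Rightarrow> nat) \<Rightarrow> nat \<Rightarrow> 'a" where
  "w \<tau> t \<equiv> projection_iterates C \<tau> w0 t"

definition res :: "'a \<Rightarrow> nat \<Rightarrow> real" where
  "res v m = (norm (v - closest_point (C m) v))\<^sup>2"

abbreviation E :: "((nat \<Rightarrow> nat) \<Rightarrow> real) \<Rightarrow> real" where
  "E \<equiv> measure_pmf.expectation P"

definition b :: "nat \<Rightarrow> real" where
  "b t = E (\<lambda>\<tau>. res (w \<tau> t) (\<tau> (Suc t)))"

lemma nonempty: "m \<in> I \<Longrightarrow> C m \<noteq> {}"
  using z_in by auto

lemma integrable [simp]: "integrable (measure_pmf P) (f :: _ \<Rightarrow> real)"
  using finite_support by (rule integrable_measure_pmf_finite)

lemma E_mono: "(\<And>\<tau>. \<tau> \<in> set_pmf P \<Longrightarrow> f \<tau> \<le> g \<tau>) \<Longrightarrow> E f \<le> E g"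
  by (intro integral_mono_AE) (auto simp: AE_measure_pmf_iff)

lemma E_exchange:
  assumes "i \<in> {1..N}" "j \<in> {1..N}"
  shows "E (\<lambda>\<tau>. f (\<tau> \<circ> Transposition.transpose i j)) = E f"
  using exchangeable[OF assms] integral_map_pmf[of "\<lambda>\<tau>. \<tau> \<circ> Transposition.transpose i j" P f] by simp

lemma res_nonneg: "0 \<le> res v m"
  by (simp add: res_def)

lemma b_nonneg: "0 \<le> b t"
  unfolding b_def by (intro Bochner_Integration.integral_nonneg) (simp add: res_nonneg)

text \<open>The iterate at time \<open>s\<close> reads only positions up to \<open>s\<close>, so
  swapping the later positions \<open>Suc s\<close> and \<open>t\<close> leaves it fixed.\<close>

lemma E_res_eq_b:
  assumes "t \<in> {Suc s..N}"
  shows "E (\<lambda>\<tau>. res (w \<tau> s) (\<tau> t)) = b s"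
proof -
  have "w (\<tau> \<circ> Transposition.transpose (Suc s) t) s = w \<tau> s" for \<tau>
    using assms by (intro projection_iterates_cong) (auto simp: Transposition.transpose_def)
  then have "E (\<lambda>\<tau>. res (w \<tau> s) (\<tau> t))
      = E (\<lambda>\<tau>. res (w (\<tau> \<circ> Transposition.transpose (Suc s) t) s) ((\<tau> \<circ> Transposition.transpose (Suc s) t) (Suc s)))"
    by simp
  also have "\<dots> = b s"
    unfolding b_def using assms by (intro E_exchange[of _ _ "\<lambda>\<tau>. res (w \<tau> s) (\<tau> (Suc s))"]) auto
  finally show ?thesis .
qed

lemma dist_anchor_step:
  assumes "\<tau> \<in> set_pmf P" "t < N"
  shows "(norm (w \<tau> (Suc t) - z))\<^sup>2 \<le> (norm (w \<tau> t - z))\<^sup>2 - res (w \<tau> t) (\<tau> (Suc t))"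
  unfolding res_def projection_iterates.simps
  using index[OF assms(1), of "Suc t"] assms(2)
  by (intro closest_point_step_in closed convex z_in) auto

text \<open>Telescoping of the exact descent towards \<open>z\<close>. Dropping the distance bounds
  the sum of the residuals; dropping the sum shows that no iterate is farther from \<open>z\<close>
  than \<open>w0\<close>.\<close>

lemma dist_anchor_plus_sum:
  assumes "\<tau> \<in> set_pmf P" "k \<le> N"
  shows "(norm (w \<tau> k - z))\<^sup>2 + (\<Sum>t<k. res (w \<tau> t) (\<tau> (Suc t))) \<le> (norm (w0 - z))\<^sup>2"
  using assms(2)
proof (induction k)
  case (Suc k)
  then show ?case
    using dist_anchor_step[OF assms(1), of k] by simp
qed simp

lemma sum_b_le:
  assumes "k \<le> N"
  shows "(\<Sum>t<k. b t) \<le> (norm (w0 - z))\<^sup>2"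
proof -
  have "(\<Sum>t<k. b t) = E (\<lambda>\<tau>. \<Sum>t<k. res (w \<tau> t) (\<tau> (Suc t)))"
    by (simp add: b_def)
  also have "\<dots> \<le> E (\<lambda>_. (norm (w0 - z))\<^sup>2)"
    using dist_anchor_plus_sum[OF _ assms]
    by (intro E_mono) (smt (verit) zero_le_power2)
  finally show ?thesis
    by simp
qed

lemma res_le_dist_anchor:
  assumes "\<tau> \<in> set_pmf P" "k \<le> N" "m \<in> I"
  shows "res (w \<tau> k) m \<le> (norm (w0 - z))\<^sup>2"
proof -
  have "norm (w \<tau> k - closest_point (C m) (w \<tau> k)) \<le> norm (w \<tau> k - z)"
    using closest_point_le[OF closed z_in] assms(3) by (simp add: dist_norm)
  then have "res (w \<tau> k) m \<le> (norm (w \<tau> k - z))\<^sup>2"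
    unfolding res_def by (simp add: power_mono)
  also have "\<dots> \<le> (norm (w0 - z))\<^sup>2"
  proof -
    have "0 \<le> (\<Sum>t<k. res (w \<tau> t) (\<tau> (Suc t)))"
      by (intro sum_nonneg res_nonneg)
    with dist_anchor_plus_sum[OF assms(1,2)] show ?thesis
      by linarith
  qed
  finally show ?thesis .
qed

text \<open>The comparison point of the descent inequality is the earlier iterate \<open>w \<tau> s\<close> itself.\<close>
lemma tail_b_le:
  assumes "s < k" "k \<le> N"
  shows "(\<Sum>t=s..<k. b t) \<le> 4 * real (k - s) * b s"
proof -
  \<comment> \<open>The squared distance to \<open>w \<tau> s\<close> starts at 0; step
    \<open>n\<close> adds at most \<open>2 * b s\<close> in expectation and removes
    \<open>b n / 2\<close>. Dropping the final distance and doubling gives the factor 4.\<close>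
  have "E (\<lambda>\<tau>. (norm (w \<tau> n - w \<tau> s))\<^sup>2) + (\<Sum>t=s..<n. b t) / 2 \<le> 2 * real (n - s) * b s"
    if "s \<le> n" "n \<le> N" for n
    using that
  proof (induction n rule: dec_induct)
    case base
    show ?case by simp
  next
    case (step n)
    have "E (\<lambda>\<tau>. (norm (w \<tau> (Suc n) - w \<tau> s))\<^sup>2)
        \<le> E (\<lambda>\<tau>. (norm (w \<tau> n - w \<tau> s))\<^sup>2 - res (w \<tau> n) (\<tau> (Suc n)) / 2
              + 2 * res (w \<tau> s) (\<tau> (Suc n)))"
      unfolding res_def projection_iterates.simps
      using index[of _ "Suc n"] step.prems
      by (intro E_mono closest_point_step closed convex nonempty) auto
    also have "\<dots> = E (\<lambda>\<tau>. (norm (w \<tau> n - w \<tau> s))\<^sup>2) - b n / 2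
        + 2 * E (\<lambda>\<tau>. res (w \<tau> s) (\<tau> (Suc n)))"
      by (simp add: b_def)
    also have "E (\<lambda>\<tau>. res (w \<tau> s) (\<tau> (Suc n))) = b s"
      using step by (intro E_res_eq_b) auto
    finally have "E (\<lambda>\<tau>. (norm (w \<tau> (Suc n) - w \<tau> s))\<^sup>2)
        \<le> E (\<lambda>\<tau>. (norm (w \<tau> n - w \<tau> s))\<^sup>2) - b n / 2 + 2 * b s" .
    moreover have "2 * real (Suc n - s) * b s = 2 * real (n - s) * b s + 2 * b s"
      using step by (simp add: Suc_diff_le algebra_simps)
    moreover have "(\<Sum>t=s..<Suc n. b t) / 2 = (\<Sum>t=s..<n. b t) / 2 + b n / 2"
      using step by simp
    ultimately show ?case
      using step.IH step.prems by linarith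
  qed
  from this[of k] assms
  have "E (\<lambda>\<tau>. (norm (w \<tau> k - w \<tau> s))\<^sup>2) + (\<Sum>t=s..<k. b t) / 2 \<le> 2 * real (k - s) * b s"
    by simp
  moreover have "0 \<le> E (\<lambda>\<tau>. (norm (w \<tau> k - w \<tau> s))\<^sup>2)"
    by (intro Bochner_Integration.integral_nonneg) simp
  ultimately show ?thesis
    by linarith
qed

lemma b_last_le:
  assumes "1 \<le> k" "k \<le> N"
  shows "root 4 (real k) * b (k - 1) \<le> 6 / 5 * (norm (w0 - z))\<^sup>2"
proof -
  let ?D = "(norm (w0 - z))\<^sup>2"
  have "(root 4 (real k) * b (k - 1)) ^ 4 = b (k - 1) ^ 4 * real k"
    by (simp add: power_mult_distrib mult.commute)
  also have "\<dots> \<le> b (k - 1) ^ 4 * (real k + 1)"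
    by (intro mult_left_mono) auto
  also have "\<dots> \<le> 2 * (\<Sum>t<k. b t) ^ 4"
    using assms by (intro last_term_bound b_nonneg tail_b_le) auto
  also have "\<dots> \<le> 2 * ?D ^ 4"
    by (intro mult_left_mono power_mono sum_b_le assms sum_nonneg b_nonneg) auto
  \<comment> \<open>6/5 is a rational upper bound for the fourth root of 2: its fourth power is
    2.0736.\<close>
  also have "\<dots> \<le> (6 / 5 * ?D) ^ 4"
    unfolding power_mult_distrib by (intro mult_right_mono) (auto simp: power4_eq_xxxx)
  finally show ?thesis
    by (rule power_mono_iff[THEN iffD1, rotated -1]) (auto simp: b_nonneg)
qed

text \<open>The last projection moves the iterate by the residual of \<open>\<tau> k\<close>.
  Stepping back to time \<open>k - 1\<close> keeps position \<open>k\<close> fresh, which matters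
  when \<open>k = N\<close> and no position \<open>k + 1\<close> is left to draw.\<close>

lemma res_last_le:
  assumes "1 \<le> k" "k \<le> N" "\<tau> \<in> set_pmf P" "m \<in> I"
  shows "res (w \<tau> k) m \<le> 2 * res (w \<tau> (k - 1)) (\<tau> k) + 2 * res (w \<tau> (k - 1)) m"
proof -
  obtain n where n: "k = Suc n"
    using assms(1) by (cases k) auto
  show ?thesis
    using closest_point_residual_le[OF closed nonempty, OF assms(4,4), of "w \<tau> k" "w \<tau> n"]
    by (simp add: res_def n norm_minus_commute)
qed

text \<open>
  Exchanging positions \<open>j\<close> and \<open>k\<close> turns an already visited set into a fresh one; nonexpansiveness
  controls the effect of the exchange on the iterate by the two residuals at time \<open>j - 1\<close>.
\<close>
lemma E_res_visited_le:
  assumes "1 \<le> j" "j < k" "k \<le> N"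
  shows "E (\<lambda>\<tau>. res (w \<tau> (k - 1)) (\<tau> j)) \<le> 2 * b (k - 1) + 8 * b (j - 1)"
proof -
  define \<sigma> where "\<sigma> \<tau> = \<tau> \<circ> Transposition.transpose j k" for \<tau> :: "nat \<Rightarrow> nat"
  obtain i where i: "j = Suc i"
    using assms(1) by (cases j) auto
  have "E (\<lambda>\<tau>. res (w \<tau> (k - 1)) (\<tau> j)) = E (\<lambda>\<tau>. res (w (\<sigma> \<tau>) (k - 1)) (\<sigma> \<tau> j))"
    unfolding \<sigma>_def using assms
    by (intro E_exchange[of _ _ "\<lambda>\<tau>. res (w \<tau> (k - 1)) (\<tau> j)", symmetric]) auto
  also have "\<dots> \<le> E (\<lambda>\<tau>. 4 * res (w \<tau> i) (\<tau> k) + 4 * res (w \<tau> i) (\<tau> j)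
                      + 2 * res (w \<tau> (k - 1)) (\<tau> k))"
  proof (rule E_mono)
    fix \<tau> assume \<tau>: "\<tau> \<in> set_pmf P"
    have I: "\<tau> l \<in> I" if "l \<in> {1..N}" for l
      using index[OF \<tau> that] .
    have eq: "w (\<sigma> \<tau>) i = w \<tau> i"
      using assms by (intro projection_iterates_cong) (auto simp: \<sigma>_def Transposition.transpose_def i)
    have \<sigma>j: "\<sigma> \<tau> j = \<tau> k"
      by (simp add: \<sigma>_def)
    \<comment> \<open>The two orders agree strictly between \<open>j\<close> and \<open>k\<close>,
      so the gap created at time \<open>j\<close> does not grow until time
      \<open>k - 1\<close>.\<close>
    have "norm (w (\<sigma> \<tau>) (k - 1) - w \<tau> (k - 1)) \<le> norm (w (\<sigma> \<tau>) j - w \<tau> j)"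
      using assms by (intro projection_iterates_nonexpansive conjI convex closed nonempty I)
        (auto simp: \<sigma>_def Transposition.transpose_def)
    then have "(norm (w (\<sigma> \<tau>) (k - 1) - w \<tau> (k - 1)))\<^sup>2 \<le> (norm (w (\<sigma> \<tau>) j - w \<tau> j))\<^sup>2"
      by (simp add: power_mono)
    also have "\<dots> = (norm (closest_point (C (\<tau> k)) (w \<tau> i) - closest_point (C (\<tau> j)) (w \<tau> i)))\<^sup>2"
      using eq \<sigma>j by (simp add: i)
    also have "\<dots> \<le> 2 * res (w \<tau> i) (\<tau> k) + 2 * res (w \<tau> i) (\<tau> j)"
      unfolding res_def by (metis norm_diff_sq_le_double norm_minus_commute)
    finally have "(norm (w (\<sigma> \<tau>) (k - 1) - w \<tau> (k - 1)))\<^sup>2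
        \<le> 2 * res (w \<tau> i) (\<tau> k) + 2 * res (w \<tau> i) (\<tau> j)" .
    moreover have "res (w (\<sigma> \<tau>) (k - 1)) (\<tau> k)
        \<le> 2 * (norm (w (\<sigma> \<tau>) (k - 1) - w \<tau> (k - 1)))\<^sup>2 + 2 * res (w \<tau> (k - 1)) (\<tau> k)"
      unfolding res_def using assms by (intro closest_point_residual_le closed nonempty I) auto
    ultimately show "res (w (\<sigma> \<tau>) (k - 1)) (\<sigma> \<tau> j)
        \<le> 4 * res (w \<tau> i) (\<tau> k) + 4 * res (w \<tau> i) (\<tau> j) + 2 * res (w \<tau> (k - 1)) (\<tau> k)"
      unfolding \<sigma>j by linarith
  qed
  also have "\<dots> = 4 * E (\<lambda>\<tau>. res (w \<tau> i) (\<tau> k)) + 4 * E (\<lambda>\<tau>. res (w \<tau> i) (\<tau> j))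
      + 2 * E (\<lambda>\<tau>. res (w \<tau> (k - 1)) (\<tau> k))"
    by simp
  \<comment> \<open>At time \<open>i = j - 1\<close> positions \<open>j\<close> and \<open>k\<close>
    are both fresh, so each contributes \<open>4 * b (j - 1)\<close>.\<close>
  also have "\<dots> = 2 * b (k - 1) + 8 * b (j - 1)"
    using assms by (subst (1 2 3) E_res_eq_b) (auto simp: i)
  finally show ?thesis .
qed

text \<open>The premise \<open>prev\<close> isolates the only estimate that depends on the kind of
  order. The constant 14 becomes 7 after the normalization by \<open>2 * T\<close>.\<close>

lemma E_avg_res_le:
  assumes k: "1 \<le> k" "k \<le> N" and T: "finite I" "I \<noteq> {}"
    and prev: "E (\<lambda>\<tau>. \<Sum>m\<in>I. res (w \<tau> (k - 1)) m)
      \<le> real (card I) * (2 * b (k - 1) + 8 / real k * (norm (w0 - z))\<^sup>2)"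
  shows "E (\<lambda>\<tau>. \<Sum>m\<in>I. res (w \<tau> k) m) \<le> 14 * real (card I) / root 4 (real k) * (norm (w0 - z))\<^sup>2"
proof -
  let ?D = "(norm (w0 - z))\<^sup>2" and ?T = "real (card I)" and ?r = "root 4 (real k)"
  have T_pos: "?T > 0"
    using T by (simp add: card_gt_0_iff)
  have r: "?r > 0"
    using k by simp
  have r4: "?r ^ 4 = real k"
    by simp
  have "?r * E (\<lambda>\<tau>. \<Sum>m\<in>I. res (w \<tau> k) m) \<le> 14 * ?T * ?D"
  \<comment> \<open>The threshold is where the fourth root equals 2. Up to it the trivial bound on
    each residual suffices; beyond it \<open>?r / real k\<close>, the inverse cube of
    \<open>?r\<close>, is at most 1/8.\<close>
  proof (cases "k \<le> 16")
    case True
    have "?r \<le> root 4 (2 ^ 4)"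
      using True by (intro real_root_le_mono) auto
    then have r2: "?r \<le> 2"
      by (simp add: real_root_power_cancel del: real_root_power)
    have "E (\<lambda>\<tau>. \<Sum>m\<in>I. res (w \<tau> k) m) \<le> E (\<lambda>_. \<Sum>m\<in>I. ?D)"
      using k by (intro E_mono sum_mono res_le_dist_anchor)
    then have "E (\<lambda>\<tau>. \<Sum>m\<in>I. res (w \<tau> k) m) \<le> ?T * ?D"
      by simp
    then have "?r * E (\<lambda>\<tau>. \<Sum>m\<in>I. res (w \<tau> k) m) \<le> 2 * (?T * ?D)"
      using r r2 by (intro mult_mono) (auto intro!: Bochner_Integration.integral_nonneg sum_nonneg res_nonneg)
    also have "\<dots> \<le> 14 * (?T * ?D)"
      by (intro mult_right_mono) auto
    finally show ?thesis by simp
  next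
    case False
    have "E (\<lambda>\<tau>. \<Sum>m\<in>I. res (w \<tau> k) m)
        \<le> E (\<lambda>\<tau>. \<Sum>m\<in>I. 2 * res (w \<tau> (k - 1)) (\<tau> k) + 2 * res (w \<tau> (k - 1)) m)"
      using k by (intro E_mono sum_mono res_last_le)
    also have "\<dots> = 2 * ?T * E (\<lambda>\<tau>. res (w \<tau> (k - 1)) (\<tau> k))
        + 2 * E (\<lambda>\<tau>. \<Sum>m\<in>I. res (w \<tau> (k - 1)) m)"
      by (simp add: sum.distrib sum_distrib_left[symmetric])
    also have "E (\<lambda>\<tau>. res (w \<tau> (k - 1)) (\<tau> k)) = b (k - 1)"
      using k by (intro E_res_eq_b) auto
    finally have "E (\<lambda>\<tau>. \<Sum>m\<in>I. res (w \<tau> k) m)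
        \<le> 2 * ?T * b (k - 1) + 2 * E (\<lambda>\<tau>. \<Sum>m\<in>I. res (w \<tau> (k - 1)) m)" .
    also have "\<dots> \<le> 2 * ?T * b (k - 1) + 2 * (?T * (2 * b (k - 1) + 8 / real k * ?D))"
      using prev by linarith
    also have "\<dots> = ?T * (6 * b (k - 1) + 16 * (?D / real k))"
      by (simp add: algebra_simps)
    finally have "?r * E (\<lambda>\<tau>. \<Sum>m\<in>I. res (w \<tau> k) m)
        \<le> ?r * (?T * (6 * b (k - 1) + 16 * (?D / real k)))"
      using r by (intro mult_left_mono) auto
    also have "\<dots> = ?T * (6 * (?r * b (k - 1)) + 16 * (?r / real k * ?D))"
      by (simp add: algebra_simps)
    \<comment> \<open>The numerical total is 7.2 + 2 = 9.2, below 14.\<close>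
    also have "\<dots> \<le> ?T * (6 * (6 / 5 * ?D) + 16 * (1 / 8 * ?D))"
    proof (intro mult_left_mono add_mono mult_right_mono b_last_le k)
      have "root 4 (2 ^ 4) \<le> ?r"
        using False by (intro real_root_le_mono) auto
      then have "2 \<le> ?r"
        by (simp add: real_root_power_cancel del: real_root_power)
      then have "?r * 2 ^ 3 \<le> ?r * ?r ^ 3"
        by (intro mult_left_mono power_mono) auto
      also have "\<dots> = real k"
        using r4 by (simp add: power_Suc[symmetric] del: power_Suc)
      finally show "?r / real k \<le> 1 / 8"
        using k by (simp add: field_simps)
    qed auto
    also have "\<dots> \<le> 14 * ?T * ?D"
      by (simp add: algebra_simps)
    finally show ?thesis .
  qed
  then show ?thesis
    using r by (simp add: field_simps)
qed

end

section \<open>Exchangeability and averaged residuals for the two kinds of random order\<close>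

lemma map_pmf_transpose_permutations:
  fixes S :: "nat set"
  assumes "finite S" "i \<in> S" "j \<in> S"
  shows "map_pmf (\<lambda>\<tau>. \<tau> \<circ> Transposition.transpose i j) (pmf_of_set {\<pi>. \<pi> permutes S})
    = pmf_of_set {\<pi>. \<pi> permutes S}"
proof (rule map_pmf_of_set_bij_betw)
  have swap: "Transposition.transpose i j permutes S"
    using assms by (simp add: permutes_swap_id)
  show "bij_betw (\<lambda>\<tau>. \<tau> \<circ> Transposition.transpose i j) {\<pi>. \<pi> permutes S} {\<pi>. \<pi> permutes S}"
    by (rule bij_betw_byWitness[where f' = "\<lambda>\<tau>. \<tau> \<circ> Transposition.transpose i j"])
      (auto simp: comp_assoc permutes_compose[OF swap])
  show "{\<pi>. \<pi> permutes S} \<noteq> {}"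
    using permutes_id by blast
qed (simp add: finite_permutations assms)

lemma exchangeable_without_replacement:
  assumes "\<And>m. m \<in> {1..T} \<Longrightarrow> closed (C m)" "\<And>m. m \<in> {1..T} \<Longrightarrow> convex (C m)"
    and "\<And>m. m \<in> {1..T} \<Longrightarrow> z \<in> C m"
  shows "exchangeable_projections C z {1..T} (ordering_without_replacement T) T"
proof -
  have "{\<pi>. \<pi> permutes {1..T}} \<noteq> {}"
    using permutes_id by blast
  then have supp: "set_pmf (ordering_without_replacement T) = {\<pi>. \<pi> permutes {1..T}}"
    by (simp add: ordering_without_replacement_def finite_permutations)
  show ?thesis
  proof unfold_locales
    show "finite (set_pmf (ordering_without_replacement T))"
      by (simp add: supp finite_permutations)
    show "\<tau> i \<in> {1..T}" if "\<tau> \<in> set_pmf (ordering_without_replacement T)" "i \<in> {1..T}" for \<tau> i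
      using that permutes_in_image[of \<tau> "{1..T}" i] by (simp add: supp)
    show "map_pmf (\<lambda>\<tau>. \<tau> \<circ> Transposition.transpose i j) (ordering_without_replacement T)
        = ordering_without_replacement T" if "i \<in> {1..T}" "j \<in> {1..T}" for i j
      unfolding ordering_without_replacement_def
      using that by (intro map_pmf_transpose_permutations) auto
  qed (use assms in auto)
qed

text \<open>All positions in \<open>{1..k}\<close> carry the same distribution, and a transposition
  of two of them preserves both this set and the default 0 outside it.\<close>

lemma exchangeable_with_replacement:
  assumes "\<And>m. m \<in> {1..T} \<Longrightarrow> closed (C m)" "\<And>m. m \<in> {1..T} \<Longrightarrow> convex (C m)"
    and "\<And>m. m \<in> {1..T} \<Longrightarrow> z \<in> C m" and "T \<ge> 1"
  shows "exchangeable_projections C z {1..T} (ordering_with_replacement T k) k"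
proof -
  have supp: "set_pmf (ordering_with_replacement T k) = PiE_dflt {1..k} 0 (\<lambda>_. {1..T})"
    using assms(4) by (simp add: ordering_with_replacement_def set_Pi_pmf comp_def)
  show ?thesis
  proof unfold_locales
    show "finite (set_pmf (ordering_with_replacement T k))"
      unfolding supp by (intro finite_PiE_dflt) auto
    show "\<tau> i \<in> {1..T}" if "\<tau> \<in> set_pmf (ordering_with_replacement T k)" "i \<in> {1..k}" for \<tau> i
      using that by (auto simp: supp PiE_dflt_def)
    show "map_pmf (\<lambda>\<tau>. \<tau> \<circ> Transposition.transpose i j) (ordering_with_replacement T k)
        = ordering_with_replacement T k" if "i \<in> {1..k}" "j \<in> {1..k}" for i j
    proof -
      have swap: "Transposition.transpose i j permutes {1..k}"
        using that by (simp add: permutes_swap_id)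
      show ?thesis
        unfolding ordering_with_replacement_def
      proof (rule Pi_pmf_bij_betw[symmetric])
        show "bij_betw (Transposition.transpose i j) {1..k} {1..k}"
          by (rule permutes_imp_bij[OF swap])
        show "Transposition.transpose i j x \<notin> {1..k}" if "x \<notin> {1..k}" for x
          using that permutes_in_image[OF swap, of x] by blast
      qed simp
    qed
  qed (use assms in auto)
qed

lemma without_replacement_E_avg_res_le:
  assumes "exchangeable_projections C z {1..T} (ordering_without_replacement T) T"
    and k: "1 \<le> k" "k \<le> T"
  defines "P \<equiv> ordering_without_replacement T"
  shows "measure_pmf.expectation P
      (\<lambda>\<tau>. \<Sum>m=1..T. exchangeable_projections.res C (projection_iterates C \<tau> w0 (k - 1)) m)
    \<le> real T * (2 * exchangeable_projections.b C w0 P (k - 1) + 8 / real k * (norm (w0 - z))\<^sup>2)"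
proof -
  interpret exchangeable_projections C w0 z "{1..T}" P T
    using assms(1) unfolding P_def .
  let ?D = "(norm (w0 - z))\<^sup>2"
  have supp: "\<tau> permutes {1..T}" if "\<tau> \<in> set_pmf P" for \<tau>
  proof -
    have "{\<pi>. \<pi> permutes {1..T}} \<noteq> {}"
      using permutes_id by blast
    with that show ?thesis
      by (simp add: P_def ordering_without_replacement_def finite_permutations)
  qed
  \<comment> \<open>Since \<open>\<tau>\<close> permutes the indices, the sum over sets becomes a
    sum over positions: those from \<open>k\<close> on are fresh at time \<open>k - 1\<close>, the
    earlier ones are visited.\<close>
  have "E (\<lambda>\<tau>. \<Sum>m=1..T. res (w \<tau> (k - 1)) m) \<le> E (\<lambda>\<tau>. \<Sum>j=1..T. res (w \<tau> (k - 1)) (\<tau> j))"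
    using sum.permute[OF supp, unfolded comp_def] by (intro E_mono eq_refl)
  also have "\<dots> = (\<Sum>j=1..T. E (\<lambda>\<tau>. res (w \<tau> (k - 1)) (\<tau> j)))"
    by simp
  also have "\<dots> \<le> (\<Sum>j=1..T. 2 * b (k - 1) + (if j < k then 8 * b (j - 1) else 0))"
  proof (rule sum_mono)
    fix j assume "j \<in> {1..T}"
    then show "E (\<lambda>\<tau>. res (w \<tau> (k - 1)) (\<tau> j)) \<le> 2 * b (k - 1) + (if j < k then 8 * b (j - 1) else 0)"
      using E_res_visited_le[of j k] E_res_eq_b[of j "k - 1"] b_nonneg[of "k - 1"] k
      by (cases "j < k") auto
  qed
  also have "\<dots> = 2 * real T * b (k - 1) + (\<Sum>j=1..T. if j < k then 8 * b (j - 1) else 0)"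
    by (simp add: sum.distrib)
  also have "(\<Sum>j=1..T. if j < k then 8 * b (j - 1) else 0) = (\<Sum>t<k - 1. 8 * b t)"
  proof -
    have "(\<Sum>j=1..T. if j < k then 8 * b (j - 1) else 0) = (\<Sum>j=Suc 0..<Suc (k - 1). 8 * b (j - 1))"
      using k by (intro sum.mono_neutral_cong_right) auto
    then show ?thesis
      by (simp only: sum.atLeast_Suc_lessThan_Suc_shift lessThan_atLeast0 comp_def diff_Suc_1)
  qed
  also have "\<dots> \<le> 8 * ?D"
    using sum_b_le[of "k - 1"] k by (simp add: sum_distrib_left[symmetric])
  \<comment> \<open>As \<open>k \<le> T\<close>, the total cost \<open>8 * ?D\<close> of the visited
    sets is at most \<open>8 / k * ?D\<close> per set.\<close>
  also have "8 * ?D \<le> real T * (8 / real k * ?D)"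
    using k mult_right_mono[of "real k" "real T" "?D"] by (simp add: field_simps)
  finally show ?thesis
    by (simp add: algebra_simps)
qed

text \<open>The last index is independent of the first \<open>k - 1\<close> ones and uniform.\<close>
lemma with_replacement_E_avg_res_eq:
  assumes "exchangeable_projections C z {1..T} (ordering_with_replacement T k) k"
    and k: "1 \<le> k" and T: "1 \<le> T"
  defines "P \<equiv> ordering_with_replacement T k"
  shows "measure_pmf.expectation P
      (\<lambda>\<tau>. \<Sum>m=1..T. exchangeable_projections.res C (projection_iterates C \<tau> w0 (k - 1)) m)
    = real T * exchangeable_projections.b C w0 P (k - 1)"
proof -
  interpret exchangeable_projections C w0 z "{1..T}" P k
    using assms(1) unfolding P_def .
  define Q where "Q = ordering_with_replacement T (k - 1)"
  define U where "U = pmf_of_set {1..T}"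
  have fin: "finite (set_pmf Q)"
    unfolding Q_def ordering_with_replacement_def using T
    by (simp add: set_Pi_pmf finite_PiE_dflt)
  have "{1..k} = insert k {1..k - 1}"
    using k by auto
  then have P: "P = U \<bind> (\<lambda>y. Q \<bind> (\<lambda>f. return_pmf (f(k := y))))"
    using k by (simp add: P_def Q_def U_def ordering_with_replacement_def Pi_pmf_insert')
  have E: "E h = (\<Sum>y=1..T. measure_pmf.expectation Q (\<lambda>f. h (f(k := y)))) / real T" for h
  proof -
    have "E h = (\<Sum>y\<in>{1..T}. measure_pmf.expectation (map_pmf (\<lambda>f. f(k := y)) Q) h / real (card {1..T}))"
      unfolding P U_def map_pmf_def[symmetric] using T fin
      by (subst pmf_expectation_bind_pmf_of_set) (auto simp: sum_distrib_left field_simps)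
    then show ?thesis
      by (simp add: sum_divide_distrib)
  qed
  have upd: "w (f(k := y)) (k - 1) = w f (k - 1)" for f y
    using k by (intro projection_iterates_cong) auto
  have int: "integrable (measure_pmf Q) g" for g :: "_ \<Rightarrow> real"
    using fin by (rule integrable_measure_pmf_finite)
  have "E (\<lambda>\<tau>. \<Sum>m=1..T. res (w \<tau> (k - 1)) m)
      = (\<Sum>m=1..T. measure_pmf.expectation Q (\<lambda>f. res (w f (k - 1)) m))"
    unfolding E upd using T int by simp
  also have "\<dots> = real T * E (\<lambda>\<tau>. res (w \<tau> (k - 1)) (\<tau> k))"
    unfolding E upd using T by simp
  also have "E (\<lambda>\<tau>. res (w \<tau> (k - 1)) (\<tau> k)) = b (k - 1)"
    using k by (intro E_res_eq_b) auto
  finally show ?thesis .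
qed

theorem theorem15:
  fixes C :: "nat \<Rightarrow> (real ^ 'd) set" and w0 :: "real ^ 'd"
    and T k :: nat and \<P> :: "(nat \<Rightarrow> nat) pmf"
  assumes "T \<ge> 1"
    and "\<And>m. m \<in> {1..T} \<Longrightarrow> closed (C m)"
    and "\<And>m. m \<in> {1..T} \<Longrightarrow> convex (C m)"
    and "(\<Inter>m\<in>{1..T}. C m) \<noteq> {}"
    and "(\<P> = ordering_with_replacement T k \<and> k \<ge> 1) \<or>
         (\<P> = ordering_without_replacement T \<and> k \<in> {1..T})"
  shows "measure_pmf.expectation \<P> (\<lambda>\<tau>. 1 / (2 * real T) *
             (\<Sum>m=1..T. (norm (projection_iterates C \<tau> w0 k
                - closest_point (C m) (projection_iterates C \<tau> w0 k)))\<^sup>2))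
         = measure_pmf.expectation \<P> (\<lambda>\<tau>. 1 / (2 * real T) *
             (\<Sum>m=1..T. (infdist (projection_iterates C \<tau> w0 k) (C m))\<^sup>2))
       \<and> measure_pmf.expectation \<P> (\<lambda>\<tau>. 1 / (2 * real T) *
             (\<Sum>m=1..T. (infdist (projection_iterates C \<tau> w0 k) (C m))\<^sup>2))
         \<le> 7 / root 4 (real k) * (INF w\<in>(\<Inter>m\<in>{1..T}. C m). (norm (w0 - w))\<^sup>2)"
proof -
  have infdist: "infdist v (C m) = norm (v - closest_point (C m) v)" if "m \<in> {1..T}" for m v
    using that assms(2,4) by (intro infdist_eq_norm_closest_point) auto
  have "closed (\<Inter>m\<in>{1..T}. C m)"
    using assms(2) by (intro closed_INT) auto
  then obtain z where z: "z \<in> (\<Inter>m\<in>{1..T}. C m)"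
    and INF: "(INF w\<in>(\<Inter>m\<in>{1..T}. C m). (norm (w0 - w))\<^sup>2) = (norm (w0 - z))\<^sup>2"
    using INF_norm_sq_is_min[OF _ assms(4), of w0] by auto
  have z': "\<And>m. m \<in> {1..T} \<Longrightarrow> z \<in> C m"
    using z by auto
  \<comment> \<open>From here on the two kinds of order enter only through \<open>N\<close> and
    \<open>prev\<close>.\<close>
  obtain N where N: "exchangeable_projections C z {1..T} \<P> N" and k: "1 \<le> k" "k \<le> N"
    and prev: "measure_pmf.expectation \<P>
      (\<lambda>\<tau>. \<Sum>m=1..T. exchangeable_projections.res C (projection_iterates C \<tau> w0 (k - 1)) m)
    \<le> real T * (2 * exchangeable_projections.b C w0 \<P> (k - 1) + 8 / real k * (norm (w0 - z))\<^sup>2)"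
    using assms(5)
  proof (elim disjE conjE)
    assume P: "\<P> = ordering_with_replacement T k" and k: "k \<ge> 1"
    have N: "exchangeable_projections C z {1..T} \<P> k"
      unfolding P using assms z' by (intro exchangeable_with_replacement) auto
    interpret exchangeable_projections C w0 z "{1..T}" \<P> k
      by (rule N)
    have "E (\<lambda>\<tau>. \<Sum>m=1..T. res (w \<tau> (k - 1)) m) = real T * b (k - 1)"
      using with_replacement_E_avg_res_eq[OF N[unfolded P] k assms(1)] by (simp add: P)
    also have "\<dots> \<le> real T * (2 * b (k - 1) + 8 / real k * (norm (w0 - z))\<^sup>2)"
      using b_nonneg[of "k - 1"] by (intro mult_left_mono add_increasing2) auto
    finally show thesis
      by (rule that[OF N k order.refl])
  next
    assume P: "\<P> = ordering_without_replacement T" and k: "k \<in> {1..T}"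
    have N: "exchangeable_projections C z {1..T} \<P> T"
      unfolding P using assms z' by (intro exchangeable_without_replacement) auto
    show thesis
      using k without_replacement_E_avg_res_le[OF N[unfolded P], of k]
      by (intro that[OF N]) (simp_all only: P atLeastAtMost_iff)
  qed
  interpret exchangeable_projections C w0 z "{1..T}" \<P> N
    by (rule N)
  have infdist_sum: "(\<Sum>m=1..T. (infdist v (C m))\<^sup>2) = (\<Sum>m=1..T. res v m)" for v
    by (intro sum.cong) (simp_all add: infdist res_def)
  have res_eq: "(norm (v - closest_point (C m) v))\<^sup>2 = res v m" for v m
    by (simp add: res_def)
  have "E (\<lambda>\<tau>. \<Sum>m=1..T. res (w \<tau> k) m) \<le> 14 * real T / root 4 (real k) * (norm (w0 - z))\<^sup>2"
    using E_avg_res_le[OF k] prev assms(1) by simp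
  then have "1 / (2 * real T) * E (\<lambda>\<tau>. \<Sum>m=1..T. res (w \<tau> k) m)
      \<le> 1 / (2 * real T) * (14 * real T / root 4 (real k) * (norm (w0 - z))\<^sup>2)"
    by (rule mult_left_mono) simp
  also have "\<dots> = 7 / root 4 (real k) * (norm (w0 - z))\<^sup>2"
    using assms(1) by simp
  finally have "E (\<lambda>\<tau>. 1 / (2 * real T) * (\<Sum>m=1..T. res (w \<tau> k) m))
      \<le> 7 / root 4 (real k) * (norm (w0 - z))\<^sup>2"
    by (simp only: integral_mult_right_zero)
  then show ?thesis
    by (simp only: INF res_eq infdist_sum simp_thms)
qed

end
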